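(* For each of the following quadratic systems, with parameter in the stated range, the limit cycle $\gamma$ given by the (real) oval of the indicated invariant algebraic curve is hyperbolic, i.e. $\int_0^T\left(\frac{\partial P}{\partial x}+\frac{\partial Q}{\partial y}\right)(\gamma(t))\,dt\neq 0$, where $T>0$ is the period of $\gamma$ and $(P,Q)$ is the vector field: (i) $\dot x=6(1+a)x+2y-6(2+a)x^2+12xy$, $\dot y=15(1+a)y+3a(1+a)x^2-2(9+5a)xy+16y^2$, with $0<a<\frac{3}{13}$, and curve $3(1+a)(ax^2+y)^2+2y^2(2y-3(1+a)x)=0$; (ii) $\dot x=5x+6x^2+4(1+a)xy+ay^2$, $\dot y=x+2y+4xy+(2+3a)y^2$, with $\frac{-71+17\sqrt{17}}{32}<a<0$, and curve $x^2+x^3+x^2y+2axy^2+2axy^3+a^2y^4=0$; (iii) $\dot x=2(1+2x-2ax^2+6xy)$, $\dot y=8-3a-14ax-2axy-8y^2$, with $0<a<\frac14$, and curve $\frac14+x-x^2+ax^3+xy+x^2y^2=0$.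
   Context: In each case the indicated curve is invariant under the system and its oval is a limit cycle of the system (a known fact for these parameter ranges). A limit cycle $\gamma$ of period $T$ is called hyperbolic when the integral of the divergence $\partial P/\partial x+\partial Q/\partial y$ along $\gamma$ over one period is nonzero. *)

theory Defs
  imports "HOL-Analysis.Analysis"
begin

definition divergence :: "(real \<Rightarrow> real \<Rightarrow> real) \<Rightarrow> (real \<Rightarrow> real \<Rightarrow> real) \<Rightarrow> real \<Rightarrow> real \<Rightarrow> real" where
  "divergence P Q u v = deriv (\<lambda>s. P s v) u + deriv (\<lambda>s. Q u s) v"

definition periodic_orbit_on ::
  "(real \<Rightarrow> real \<Rightarrow> real) \<Rightarrow> (real \<Rightarrow> real \<Rightarrow> real) \<Rightarrow> (real \<Rightarrow> real \<Rightarrow> real)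
   \<Rightarrow> (real \<Rightarrow> real) \<Rightarrow> (real \<Rightarrow> real) \<Rightarrow> real \<Rightarrow> bool" where
  "periodic_orbit_on P Q F x y T \<longleftrightarrow>
     T > 0 \<and>
     (\<forall>t. (x has_real_derivative P (x t) (y t)) (at t) \<and>
          (y has_real_derivative Q (x t) (y t)) (at t)) \<and>
     (\<forall>t. x (t + T) = x t \<and> y (t + T) = y t) \<and>
     (\<forall>t. F (x t) (y t) = 0) \<and>
     \<not> (\<forall>t. x t = x 0 \<and> y t = y 0)"

definition hyperbolic_cycle ::
  "(real \<Rightarrow> real \<Rightarrow> real) \<Rightarrow> (real \<Rightarrow> real \<Rightarrow> real) \<Rightarrow> (real \<Rightarrow> real) \<Rightarrow> (real \<Rightarrow> real) \<Rightarrow> real \<Rightarrow> bool" where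
  "hyperbolic_cycle P Q x y T \<longleftrightarrow> integral {0..T} (\<lambda>t. divergence P Q (x t) (y t)) \<noteq> 0"

definition P1 :: "real \<Rightarrow> real \<Rightarrow> real \<Rightarrow> real" where
  "P1 a x y = 6*(1+a)*x + 2*y - 6*(2+a)*x^2 + 12*x*y"
definition Q1 :: "real \<Rightarrow> real \<Rightarrow> real \<Rightarrow> real" where
  "Q1 a x y = 15*(1+a)*y + 3*a*(1+a)*x^2 - 2*(9+5*a)*x*y + 16*y^2"
definition F1 :: "real \<Rightarrow> real \<Rightarrow> real \<Rightarrow> real" where
  "F1 a x y = 3*(1+a)*(a*x^2 + y)^2 + 2*y^2*(2*y - 3*(1+a)*x)"

definition P2 :: "real \<Rightarrow> real \<Rightarrow> real \<Rightarrow> real" where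
  "P2 a x y = 5*x + 6*x^2 + 4*(1+a)*x*y + a*y^2"
definition Q2 :: "real \<Rightarrow> real \<Rightarrow> real \<Rightarrow> real" where
  "Q2 a x y = x + 2*y + 4*x*y + (2+3*a)*y^2"
definition F2 :: "real \<Rightarrow> real \<Rightarrow> real \<Rightarrow> real" where
  "F2 a x y = x^2 + x^3 + x^2*y + 2*a*x*y^2 + 2*a*x*y^3 + a^2*y^4"

definition P3 :: "real \<Rightarrow> real \<Rightarrow> real \<Rightarrow> real" where
  "P3 a x y = 2*(1 + 2*x - 2*a*x^2 + 6*x*y)"
definition Q3 :: "real \<Rightarrow> real \<Rightarrow> real \<Rightarrow> real" where
  "Q3 a x y = 8 - 3*a - 14*a*x - 2*a*x*y - 8*y^2"
definition F3 :: "real \<Rightarrow> real \<Rightarrow> real \<Rightarrow> real" where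
  "F3 a x y = 1/4 + x - x^2 + a*x^3 + x*y + x^2*y^2"

end

theory Submission
  imports Defs
begin

text \<open>
  On each oval a suitable pair \<open>(s, v)\<close> satisfies an equation \<open>v\<^sup>2 = c(s)\<close>, so that the oval is symmetric
  under \<open>v \<mapsto> - v\<close>, and \<open>s' = v \<sqdot> h\<close> with \<open>h\<close> of constant sign.  The divergence is then the derivative along
  the orbit of a function on the oval (logarithms, one rational function and an antiderivative \<open>H(s)\<close>), which
  integrates to zero over a period, plus a remainder of constant sign that does not vanish identically.
  A periodic orbit on another branch of the curve is impossible: a function that is monotone
  along that branch has a critical point on the orbit by Rolle's theorem, and such a point turns out to be an equilibrium.
\<close>

section \<open>Calculus on the line\<close>

lemma Rolle_real_derivative:
  fixes g g' :: "real \<Rightarrow> real"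
  assumes "a < b" "\<And>t. (g has_real_derivative g' t) (at t)" "g b = g a"
  obtains t where "t \<in> {a..b}" "g' t = 0"
proof -
  have "continuous_on {a..b} g"
    using assms(2) by (rule DERIV_continuous_on[OF has_field_derivative_at_within])
  then have "\<exists>t. a < t \<and> t < b \<and> (*) (g' t) = (\<lambda>_. 0)"
    using assms by (intro Rolle_deriv) (auto simp: has_field_derivative_def)
  then show thesis
    using that by (metis atLeastAtMost_iff less_imp_le mult.right_neutral)
qed

lemma Rolle_mult_powr:
  fixes f f' g g' :: "real \<Rightarrow> real"
  assumes "a < b" and f: "\<And>t. (f has_real_derivative f' t) (at t)" and g: "\<And>t. (g has_real_derivative g' t) (at t)"
    and pos: "\<And>t. 0 < g t" and closed: "f b = f a" "g b = g a"
  obtains t where "t \<in> {a..b}" "f' t * g t + c * f t * g' t = 0"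
proof -
  have "((\<lambda>t. f t * g t powr c) has_real_derivative (f' t * g t + c * f t * g' t) * g t powr (c - 1)) (at t)" for t
    using pos[of t] by (auto intro!: derivative_eq_intros f g simp: powr_diff field_simps)
  from Rolle_real_derivative[OF \<open>a < b\<close> this]
  obtain t where "t \<in> {a..b}" "(f' t * g t + c * f t * g' t) * g t powr (c - 1) = 0"
    using closed by metis
  then show thesis
    using that pos[of t] by simp
qed

lemma connected_nonvanishing_constant_sign:
  fixes f :: "'a::topological_space \<Rightarrow> real"
  assumes "connected S" "continuous_on S f" "\<And>x. x \<in> S \<Longrightarrow> f x \<noteq> 0"
  shows "(\<forall>x\<in>S. 0 < f x) \<or> (\<forall>x\<in>S. f x < 0)"
proof (rule ccontr)
  assume "\<not> ?thesis"
  then obtain x y where "x \<in> S" "y \<in> S" "f x \<le> 0" "0 \<le> f y"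
    by (meson not_le)
  then have "0 \<in> f ` S"
    using connected_continuous_image[OF assms(2,1)] by (blast intro: connectedD_interval)
  then show False
    using assms(3) by force
qed

lemma closed_nonvanishing_pos:
  fixes f f' g g' :: "real \<Rightarrow> real"
  assumes "a < b" and f: "\<And>t. (f has_real_derivative f' t) (at t)" and g: "\<And>t. (g has_real_derivative g' t) (at t)"
    and nonzero: "\<And>t. g t \<noteq> 0" and closed: "f b = f a" "g b = g a"
    and noncritical: "\<And>t. g t < 0 \<Longrightarrow> f' t * g t + c * f t * g' t \<noteq> 0"
  shows "0 < g t"
proof (rule ccontr)
  assume "\<not> 0 < g t"
  moreover have "continuous_on UNIV g"
    using g by (rule DERIV_continuous_on[OF has_field_derivative_at_within])
  ultimately have neg: "g u < 0" for u
    using connected_nonvanishing_constant_sign[OF connected_UNIV, of g] nonzero by auto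
  have "((\<lambda>u. - g u) has_real_derivative - g' u) (at u)" for u
    using g by (rule DERIV_minus)
  from Rolle_mult_powr[OF \<open>a < b\<close> f this, of c] neg closed
  obtain u where "f' u * - g u + c * f u * - g' u = 0"
    by auto
  then show False
    using noncritical[OF neg, of u] by simp
qed

lemma antiderivative_greaterThan:
  fixes f :: "real \<Rightarrow> real"
  assumes "continuous_on {c<..} f"
  obtains F where "\<And>u. c < u \<Longrightarrow> (F has_real_derivative f u) (at u)"
proof -
  have "isCont f u" if "ereal c < ereal u" for u
    using assms that by (simp add: continuous_on_eq_continuous_at)
  then show thesis
    using einterval_antiderivative[of "ereal c" \<infinity> f] that
    by (auto simp: has_real_derivative_iff_has_vector_derivative)
qed

lemma integral_exact_plus_nonneg_nonzero:
  fixes G f k :: "real \<Rightarrow> real"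
  assumes "a < b" and G: "\<And>t. (G has_real_derivative f t - c * k t) (at t)" and "G b = G a" and "c \<noteq> 0"
    and k: "continuous_on {a..b} k" "\<And>t. t \<in> {a..b} \<Longrightarrow> 0 \<le> k t" and nonzero: "\<tau> \<in> {a..b}" "k \<tau> \<noteq> 0"
  shows "integral {a..b} f \<noteq> 0"
proof -
  have "((\<lambda>t. f t - c * k t) has_integral G b - G a) {a..b}"
    using \<open>a < b\<close> G by (intro fundamental_theorem_of_calculus)
      (auto simp: has_real_derivative_iff_has_vector_derivative intro: has_vector_derivative_at_within)
  moreover have "(k has_integral integral {a..b} k) {a..b}"
    using k(1) by (simp add: integrable_continuous_real integrable_integral)
  ultimately have "((\<lambda>t. (f t - c * k t) + c * k t) has_integral (G b - G a) + c * integral {a..b} k) {a..b}"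
    by (intro has_integral_add has_integral_mult_right)
  then have "integral {a..b} f = c * integral {a..b} k"
    using \<open>G b = G a\<close> by (simp add: integral_unique)
  moreover have "integral {a..b} k \<noteq> 0"
    using integral_eq_0_iff[OF k(1) \<open>a < b\<close> k(2)] nonzero by blast
  ultimately show ?thesis
    using \<open>c \<noteq> 0\<close> by simp
qed

section \<open>Equilibria of polynomial vector fields\<close>

lemma has_real_derivative_norm_squared:
  fixes z :: "real \<Rightarrow> 'a::real_inner"
  assumes "(z has_vector_derivative z') (at t)"
  shows "((\<lambda>t. (norm (z t))\<^sup>2) has_real_derivative 2 * (z t \<bullet> z')) (at t)"
proof -
  have "((\<lambda>t. z t \<bullet> z t) has_derivative (\<lambda>h. z t \<bullet> (h *\<^sub>R z') + (h *\<^sub>R z') \<bullet> z t)) (at t)"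
    using assms unfolding has_vector_derivative_def by (intro has_derivative_inner)
  then show ?thesis
    unfolding power2_norm_eq_inner
    by (rule has_derivative_imp_has_field_derivative) (simp add: inner_commute)
qed

lemma norm_derivative_le_imp_zero:
  fixes z z' :: "real \<Rightarrow> 'a::real_inner"
  assumes z: "\<And>u. (z has_vector_derivative z' u) (at u)"
    and bound: "\<And>u. u \<in> closed_segment a b \<Longrightarrow> norm (z' u) \<le> L * norm (z u)" and "z a = 0"
  shows "z b = 0"
proof -
  define u where "u \<tau> = a + \<tau> * (b - a)" for \<tau>
  define \<phi> where "\<phi> \<tau> = (norm (z (u \<tau>)))\<^sup>2" for \<tau>
  define C where "C = 2 * \<bar>b - a\<bar> * L"
  have d\<phi>: "(\<phi> has_real_derivative 2 * (b - a) * (z (u \<tau>) \<bullet> z' (u \<tau>))) (at \<tau>)" for \<tau>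
  proof -
    have "(u has_real_derivative b - a) (at \<tau>)"
      unfolding u_def[abs_def] by (auto intro!: derivative_eq_intros)
    from DERIV_chain2[OF has_real_derivative_norm_squared[OF z] this] show ?thesis
      by (simp add: \<phi>_def[abs_def] algebra_simps)
  qed
  have "\<phi> 1 * exp (- C * 1) \<le> \<phi> 0 * exp (- C * 0)"
  proof (rule DERIV_nonpos_imp_nonincreasing[OF zero_le_one])
    fix \<tau> :: real assume "0 \<le> \<tau>" "\<tau> \<le> 1"
    then have "u \<tau> \<in> closed_segment a b"
      unfolding closed_segment_def u_def by (auto intro!: exI[of _ \<tau>] simp: algebra_simps)
    then have "norm (z (u \<tau>)) * norm (z' (u \<tau>)) \<le> norm (z (u \<tau>)) * (L * norm (z (u \<tau>)))"
      by (intro mult_left_mono bound) simp_all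
    then have "\<bar>z (u \<tau>) \<bullet> z' (u \<tau>)\<bar> \<le> L * \<phi> \<tau>"
      using Cauchy_Schwarz_ineq2[of "z (u \<tau>)" "z' (u \<tau>)"]
      unfolding \<phi>_def power2_eq_square by (simp add: mult.left_commute)
    then have "2 * \<bar>b - a\<bar> * \<bar>z (u \<tau>) \<bullet> z' (u \<tau>)\<bar> \<le> C * \<phi> \<tau>"
      unfolding C_def mult.assoc by (intro mult_left_mono) simp_all
    moreover have "2 * (b - a) * (z (u \<tau>) \<bullet> z' (u \<tau>)) \<le> 2 * \<bar>b - a\<bar> * \<bar>z (u \<tau>) \<bullet> z' (u \<tau>)\<bar>"
      using abs_ge_self[of "2 * (b - a) * (z (u \<tau>) \<bullet> z' (u \<tau>))"] by (simp only: abs_mult abs_numeral)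
    ultimately have "(2 * (b - a) * (z (u \<tau>) \<bullet> z' (u \<tau>)) - C * \<phi> \<tau>) * exp (- C * \<tau>) \<le> 0"
      by (simp add: mult_nonpos_nonneg)
    moreover have "((\<lambda>\<tau>. \<phi> \<tau> * exp (- C * \<tau>)) has_real_derivative
        (2 * (b - a) * (z (u \<tau>) \<bullet> z' (u \<tau>)) - C * \<phi> \<tau>) * exp (- C * \<tau>)) (at \<tau>)"
      by (auto intro!: derivative_eq_intros d\<phi> simp: algebra_simps)
    ultimately show "\<exists>d. ((\<lambda>\<tau>. \<phi> \<tau> * exp (- C * \<tau>)) has_real_derivative d) (at \<tau>) \<and> d \<le> 0"
      by blast
  qed
  then show ?thesis
    using \<open>z a = 0\<close> by (simp add: \<phi>_def u_def mult_le_0_iff not_le)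
qed

lemma lipschitz_on_mult:
  fixes f g :: "'a::metric_space \<Rightarrow> real"
  assumes L: "L-lipschitz_on S f" and M: "M-lipschitz_on S g"
    and A: "\<And>z. z \<in> S \<Longrightarrow> \<bar>f z\<bar> \<le> A" and B: "\<And>z. z \<in> S \<Longrightarrow> \<bar>g z\<bar> \<le> B" and "0 \<le> A" "0 \<le> B"
  shows "(A * M + B * L)-lipschitz_on S (\<lambda>z. f z * g z)"
proof (rule lipschitz_onI)
  fix z w assume "z \<in> S" "w \<in> S"
  have "f z * g z - f w * g w = f z * (g z - g w) + g w * (f z - f w)"
    by (simp add: algebra_simps)
  then have "\<bar>f z * g z - f w * g w\<bar> \<le> \<bar>f z\<bar> * \<bar>g z - g w\<bar> + \<bar>g w\<bar> * \<bar>f z - f w\<bar>"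
    by (metis abs_mult abs_triangle_ineq)
  also have "\<dots> \<le> A * (M * dist z w) + B * (L * dist z w)"
    using A[OF \<open>z \<in> S\<close>] B[OF \<open>w \<in> S\<close>]
      lipschitz_onD[OF L \<open>z \<in> S\<close> \<open>w \<in> S\<close>] lipschitz_onD[OF M \<open>z \<in> S\<close> \<open>w \<in> S\<close>]
      \<open>0 \<le> A\<close> \<open>0 \<le> B\<close>
    by (intro add_mono mult_mono) (auto simp: dist_real_def)
  finally show "dist (f z * g z) (f w * g w) \<le> (A * M + B * L) * dist z w"
    by (simp add: dist_real_def algebra_simps)
qed (use L M \<open>0 \<le> A\<close> \<open>0 \<le> B\<close> in \<open>simp add: lipschitz_on_nonneg\<close>)

lemma real_polynomial_function_lipschitz_on:
  fixes p :: "'a::euclidean_space \<Rightarrow> real"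
  assumes "real_polynomial_function p" "bounded S"
  shows "\<exists>L. L-lipschitz_on S p"
  using assms(1)
proof induction
  case (linear f)
  then show ?case
    by (metis bounded_linear.lipschitz_boundE)
next
  case (const c)
  then show ?case
    by (blast intro: lipschitz_on_constant)
next
  case (add f g)
  then show ?case
    by (blast intro: lipschitz_on_add)
next
  case (mult f g)
  then obtain L M where L: "L-lipschitz_on S f" and M: "M-lipschitz_on S g"
    by blast
  have "bounded (f ` S)" "bounded (g ` S)"
    using L M assms(2) by (meson bounded_uniformly_continuous_image lipschitz_on_uniformly_continuous)+
  then obtain A B where "0 < A" "0 < B" "\<And>z. z \<in> S \<Longrightarrow> \<bar>f z\<bar> \<le> A" "\<And>z. z \<in> S \<Longrightarrow> \<bar>g z\<bar> \<le> B"
    by (auto simp: bounded_pos)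
  then have "(A * M + B * L)-lipschitz_on S (\<lambda>z. f z * g z)"
    using L M by (intro lipschitz_on_mult) auto
  then show ?case ..
qed

lemma solution_through_equilibrium_constant:
  fixes z :: "real \<Rightarrow> 'a::euclidean_space"
  assumes z: "\<And>u. (z has_vector_derivative X (z u)) (at u)"
    and X: "\<And>S. bounded S \<Longrightarrow> \<exists>L. L-lipschitz_on S X" and "X (z s) = 0"
  shows "z t = z s"
proof -
  have "continuous_on (closed_segment s t) z"
    using z by (intro continuous_at_imp_continuous_on ballI) (rule has_vector_derivative_continuous)
  then have "bounded (z ` closed_segment s t)"
    by (intro compact_imp_bounded compact_continuous_image compact_segment)
  then obtain L where L: "L-lipschitz_on (z ` closed_segment s t) X"
    using X by blast
  have "z t - z s = 0"
  proof (rule norm_derivative_le_imp_zero[where z = "\<lambda>u. z u - z s" and a = s])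
    show "((\<lambda>u. z u - z s) has_vector_derivative X (z u)) (at u)" for u
      using z by (auto intro!: derivative_eq_intros)
    show "norm (X (z u)) \<le> L * norm (z u - z s)" if "u \<in> closed_segment s t" for u
      using lipschitz_on_normD[OF L, of "z u" "z s"] that \<open>X (z s) = 0\<close> by simp
  qed simp
  then show ?thesis by simp
qed

section \<open>Periodic orbits in the plane\<close>

locale planar_orbit =
  fixes P Q F :: "real \<Rightarrow> real \<Rightarrow> real" and x y :: "real \<Rightarrow> real" and T :: real
  assumes periodic_orbit: "periodic_orbit_on P Q F x y T"
begin

lemma period_pos: "0 < T"
  and on_curve: "F (x t) (y t) = 0"
  and closed_x: "x T = x 0"
  and closed_y: "y T = y 0"
  using periodic_orbit unfolding periodic_orbit_on_def by (auto dest: spec[of _ 0])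

lemma has_derivative_x [derivative_intros]: "(x has_real_derivative P (x t) (y t)) (at t)"
  and has_derivative_y [derivative_intros]: "(y has_real_derivative Q (x t) (y t)) (at t)"
  using periodic_orbit unfolding periodic_orbit_on_def by auto

lemma continuous_on_x [continuous_intros]: "continuous_on S x"
  and continuous_on_y [continuous_intros]: "continuous_on S y"
  by (rule DERIV_continuous_on[OF has_field_derivative_at_within], rule has_derivative_x has_derivative_y)+

lemma not_equilibrium:
  assumes P: "real_polynomial_function (\<lambda>z. P (fst z) (snd z))"
    and Q: "real_polynomial_function (\<lambda>z. Q (fst z) (snd z))"
  shows "P (x t) (y t) \<noteq> 0 \<or> Q (x t) (y t) \<noteq> 0"
proof (rule ccontr)
  assume "\<not> ?thesis"
  then have equilibrium: "P (x t) (y t) = 0" "Q (x t) (y t) = 0"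
    by auto
  define X where "X z = (P (fst z) (snd z), Q (fst z) (snd z))" for z
  have "(x u, y u) = (x t, y t)" for u
  proof (rule solution_through_equilibrium_constant[where X = X and z = "\<lambda>u. (x u, y u)"])
    show "((\<lambda>u. (x u, y u)) has_vector_derivative X (x u, y u)) (at u)" for u
      using has_derivative_x has_derivative_y
      by (auto simp: X_def has_real_derivative_iff_has_vector_derivative intro!: has_vector_derivative_Pair)
    show "\<exists>L. L-lipschitz_on S X" if "bounded S" for S
    proof -
      obtain L M where "L-lipschitz_on S (\<lambda>z. P (fst z) (snd z))" "M-lipschitz_on S (\<lambda>z. Q (fst z) (snd z))"
        using P Q \<open>bounded S\<close> by (meson real_polynomial_function_lipschitz_on)
      from lipschitz_on_Pair[OF this] show ?thesis
        unfolding X_def[abs_def] by blast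
    qed
    show "X (x t, y t) = 0"
      using equilibrium by (simp add: X_def zero_prod_def)
  qed
  then have "x u = x 0 \<and> y u = y 0" for u
    by (metis prod.inject)
  then show False
    using periodic_orbit unfolding periodic_orbit_on_def by blast
qed

end

lemma divergence_eqI:
  assumes "((\<lambda>s. P s v) has_real_derivative p) (at u)" "((\<lambda>s. Q u s) has_real_derivative q) (at v)"
  shows "divergence P Q u v = p + q"
  using assms by (simp add: divergence_def DERIV_imp_deriv)

lemmas real_polynomial_function_planar =
  real_polynomial_function.intros(1)[OF bounded_linear_fst] real_polynomial_function.intros(1)[OF bounded_linear_snd]
  real_polynomial_function.intros(2-4)
  real_polynomial_function_diff real_polynomial_function_power

section \<open>The first system\<close>

lemma divergence_P1_Q1: "divergence (P1 a) (Q1 a) u v = 21 * (1 + a) - (42 + 22 * a) * u + 44 * v"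
proof -
  have "divergence (P1 a) (Q1 a) u v
      = (6 * (1 + a) - 12 * (2 + a) * u + 12 * v) + (15 * (1 + a) - 2 * (9 + 5 * a) * u + 32 * v)"
    unfolding P1_def Q1_def by (rule divergence_eqI) (auto intro!: derivative_eq_intros)
  then show ?thesis by (simp add: algebra_simps)
qed

lemma real_polynomial_function_P1_Q1:
  "real_polynomial_function (\<lambda>z. P1 a (fst z) (snd z))" "real_polynomial_function (\<lambda>z. Q1 a (fst z) (snd z))"
  unfolding P1_def Q1_def by (intro real_polynomial_function_planar)+

lemma F1_lower_half_plane_tangent_imp_equilibrium:
  fixes a x y :: real
  assumes F: "F1 a x y = 0" and "y < 0" "0 < a" and tangent: "x * Q1 a x y = 2 * y * P1 a x y"
  shows "P1 a x y = 0 \<and> Q1 a x y = 0"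
proof -
  define U where "U = 2 * x * y + a * x\<^sup>2 + y"
  have "(3 * (1 + a) * x - 4 * y) * U = x * Q1 a x y - 2 * y * P1 a x y"
    unfolding U_def P1_def Q1_def by (simp add: algebra_simps eval_nat_numeral)
  moreover have "3 * (1 + a) * x - 4 * y \<noteq> 0"
  proof
    assume "3 * (1 + a) * x - 4 * y = 0"
    then have "F1 a x y = 3 * (1 + a) * (a * x\<^sup>2 + y)\<^sup>2 - 4 * y^3"
      unfolding F1_def by (simp add: algebra_simps eval_nat_numeral)
    moreover have "y^3 < 0"
      using \<open>y < 0\<close> by simp
    moreover have "0 \<le> 3 * (1 + a) * (a * x\<^sup>2 + y)\<^sup>2"
      using \<open>0 < a\<close> by simp
    ultimately show False
      using F by linarith
  qed
  ultimately have U: "U = 0"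
    using tangent by simp
  have "y\<^sup>2 * (x * Q1 a x y - y * P1 a x y) - 3 / 2 * (1 + a) * (y\<^sup>2 - a\<^sup>2 * x^4) * U
      = (a / 2 * x\<^sup>2 - y / 2 + x * y) * F1 a x y"
    unfolding U_def P1_def Q1_def F1_def by (simp add: field_simps eval_nat_numeral)
  then have "x * Q1 a x y = y * P1 a x y"
    using F U \<open>y < 0\<close> by simp
  then have "P1 a x y = 0" "x * Q1 a x y = 0"
    using tangent \<open>y < 0\<close> by auto
  moreover have "x \<noteq> 0"
    using U \<open>y < 0\<close> by (auto simp: U_def)
  ultimately show ?thesis by simp
qed

locale system1 =
  fixes a :: real
  assumes a_pos: "0 < a" and a_less: "a < 3/13"
begin

definition b :: real where "b = 3/4 * (1 + a)"
definition q :: "real \<Rightarrow> real" where "q s = 4 * s\<^sup>2 + (5 * a - 3) * s + 4 * a\<^sup>2"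
definition p :: "real \<Rightarrow> real" where "p s = s + (3 + 5 * a) / 2"
definition E :: "real \<Rightarrow> real" where "E s = s\<^sup>2 + (6 + 7 * a) * s + 3 * a * (1 + a)"

text \<open>
  Even and odd refer to the reflection \<open>v \<mapsto> - v\<close>: after subtracting the derivative of \<open>4 ln (w / s)\<close>, the divergence
  is \<open>even_part(s) \<sqdot> w + odd_part(s) \<sqdot> s'\<close>.  Up to a positive factor, \<open>weight\<close> is what is left of the even part after also
  subtracting the derivatives of \<open>- 1/5 ln ((b + v) / (b - v))\<close> and \<open>2/5 v (s - a) / (s + a)\<close>.  The coefficient \<open>1/5\<close>
  is forced: as \<open>a\<close> tends to \<open>3/13\<close> the oval shrinks to a point with \<open>s = a\<close>, where the weight must have a double zero.
\<close>

definition odd_part :: "real \<Rightarrow> real" where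
  "odd_part s = - a * (p s + 2 * (b * (s - a) / s)) / ((s + a) * E s)"

definition even_part :: "real \<Rightarrow> real" where
  "even_part s = 2 * a * b * (q s - 2 * (s - a) * p s) / (s * (s + a) * E s)"

definition weight :: "real \<Rightarrow> real" where
  "weight s = (s - a) * s * (s + a) * E s - ((s - a)\<^sup>2 * (s + a)\<^sup>2 + a * s * q s) * E s
     + 5/2 * a * s * (s + a) * (q s - 2 * (s - a) * p s)"

lemma b_pos: "0 < b"
  using a_pos by (simp add: b_def)

lemma E_pos: "0 < s \<Longrightarrow> 0 < E s"
  using a_pos by (simp add: E_def add_pos_pos)

lemma even_part_eq:
  assumes "0 < s"
  shows "even_part s =
     4/5 * b * (weight s / (s\<^sup>2 * (s + a)\<^sup>2 * E s))
     - 4/5 * b * ((s - a) / (s * (s + a))) + 4/5 * b * ((s - a)\<^sup>2 / s\<^sup>2 + a * q s / (s * (s + a)\<^sup>2))"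
proof -
  have nonzero: "s \<noteq> 0" "s + a \<noteq> 0" "E s \<noteq> 0"
    using assms a_pos E_pos[OF assms] by auto
  define K where "K = 4/5 * b / (s\<^sup>2 * (s + a)\<^sup>2 * E s)"
  have "even_part s = K * (5/2 * a * s * (s + a) * (q s - 2 * (s - a) * p s))"
    unfolding even_part_def K_def using nonzero by (simp add: power2_eq_square)
  also have "\<dots> = K * weight s - K * ((s - a) * s * (s + a) * E s)
      + (K * ((s - a)\<^sup>2 * (s + a)\<^sup>2 * E s) + K * (a * s * q s * E s))"
    unfolding weight_def by (simp add: algebra_simps)
  also have "K * ((s - a) * s * (s + a) * E s) = 4/5 * b * ((s - a) / (s * (s + a)))"
    unfolding K_def using nonzero by (simp add: power2_eq_square)
  also have "K * ((s - a)\<^sup>2 * (s + a)\<^sup>2 * E s) = 4/5 * b * ((s - a)\<^sup>2 / s\<^sup>2)"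
    unfolding K_def using nonzero by simp
  also have "K * (a * s * q s * E s) = 4/5 * b * (a * q s / (s * (s + a)\<^sup>2))"
    unfolding K_def using nonzero by (simp add: power2_eq_square)
  finally show ?thesis
    unfolding K_def by (simp add: distrib_left)
qed

lemma continuous_on_odd_part: "continuous_on {0<..} odd_part"
proof -
  have "continuous_on {0<..} E"
    unfolding E_def[abs_def] by (intro continuous_intros)
  moreover have "E s \<noteq> 0" "s + a \<noteq> 0" "s \<noteq> 0" if "0 < s" for s
    using E_pos[OF that] a_pos that by auto
  ultimately show ?thesis
    unfolding odd_part_def[abs_def] p_def by (auto intro!: continuous_intros)
qed

lemma weight_eq:
  "weight s = (s - a)\<^sup>2 * ((1 - 3 * a) / 4 * s^3 + (3/2 - 7/4 * a - 21/4 * a\<^sup>2) * s\<^sup>2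
       + a * (9/4 + a - 9/4 * a\<^sup>2) * s - a * q s / 2)
     - q s * (s + a) / 4 * (s^3 + (6 + 8 * a) * s\<^sup>2 + (a + 10 * a\<^sup>2) * s + a\<^sup>2 + 3 * a^3)"
  unfolding weight_def q_def p_def E_def by (simp add: field_simps eval_nat_numeral)

lemma weight_pos:
  assumes "0 < s" and q: "q s \<le> 0"
  shows "0 < weight s"
proof -
  define A where "A = (1 - 3 * a) / 4 * s^3 + (3/2 - 7/4 * a - 21/4 * a\<^sup>2) * s\<^sup>2
    + a * (9/4 + a - 9/4 * a\<^sup>2) * s - a * q s / 2"
  define C where "C = s^3 + (6 + 8 * a) * s\<^sup>2 + (a + 10 * a\<^sup>2) * s + a\<^sup>2 + 3 * a^3"
  have weight: "weight s = (s - a)\<^sup>2 * A - q s * (s + a) / 4 * C"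
    unfolding A_def C_def by (rule weight_eq)
  have "a\<^sup>2 < 3/13 * a"
    using a_pos a_less by (simp add: power2_eq_square)
  then have "0 < (1 - 3 * a) / 4 * s^3" "0 < (3/2 - 7/4 * a - 21/4 * a\<^sup>2) * s\<^sup>2" "0 < a * (9/4 + a - 9/4 * a\<^sup>2) * s"
    using a_pos a_less \<open>0 < s\<close> by (auto intro!: mult_pos_pos)
  moreover have "a * q s / 2 \<le> 0"
    using a_pos q by (simp add: mult_nonneg_nonpos)
  ultimately have A: "0 < A"
    unfolding A_def by linarith
  have C: "0 < C"
    unfolding C_def using a_pos \<open>0 < s\<close> by (simp add: add_pos_pos)
  have nonneg: "0 \<le> (s - a)\<^sup>2 * A" "q s * (s + a) / 4 * C \<le> 0"
    using A C a_pos \<open>0 < s\<close> q by (simp_all add: mult_nonpos_nonneg)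
  show ?thesis
  proof (cases "s = a")
    case True
    then have "q s = - (a * (3 - 13 * a))"
      unfolding q_def by (simp add: algebra_simps power2_eq_square)
    then have "q s < 0"
      using a_pos a_less by simp
    then have "q s * (s + a) / 4 * C < 0"
      using C a_pos \<open>0 < s\<close> by (simp add: mult_neg_pos)
    then show ?thesis
      unfolding weight using nonneg by linarith
  next
    case False
    then have "0 < (s - a)\<^sup>2 * A"
      using A by simp
    then show ?thesis
      unfolding weight using nonneg by linarith
  qed
qed

end

locale system1_orbit = system1 a + planar_orbit "P1 a" "Q1 a" "F1 a" x y T for a x y T
begin

lemma y_nonzero: "y t \<noteq> 0"
  using on_curve[of t] not_equilibrium[OF real_polynomial_function_P1_Q1, of t] a_pos
  by (auto simp: F1_def P1_def Q1_def)

lemma y_pos: "0 < y t"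
proof (rule closed_nonvanishing_pos[OF period_pos has_derivative_x has_derivative_y y_nonzero closed_x closed_y])
  show "P1 a (x u) (y u) * y u + - 1/2 * x u * Q1 a (x u) (y u) \<noteq> 0" if "y u < 0" for u
    using F1_lower_half_plane_tangent_imp_equilibrium[OF on_curve that a_pos]
      not_equilibrium[OF real_polynomial_function_P1_Q1, of u] by (auto simp: mult_ac)
qed

lemma x_pos: "0 < x t"
proof (rule ccontr)
  assume "\<not> 0 < x t"
  then have "3 * (1 + a) * x t \<le> 0"
    using a_pos by (intro mult_nonneg_nonpos) auto
  then have "0 < 2 * (y t)\<^sup>2 * (2 * y t - 3 * (1 + a) * x t)"
    using y_pos[of t] by simp
  moreover have "0 \<le> 3 * (1 + a) * (a * (x t)\<^sup>2 + y t)\<^sup>2"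
    using a_pos by simp
  ultimately show False
    using on_curve[of t] unfolding F1_def by linarith
qed

definition s :: "real \<Rightarrow> real" where "s t = y t / (x t)\<^sup>2"
definition v :: "real \<Rightarrow> real" where "v t = y t / x t - b"
definition w :: "real \<Rightarrow> real" where "w t = 2 * v t + p (s t)"

lemma s_pos: "0 < s t"
  using x_pos[of t] y_pos[of t] by (simp add: s_def)

lemma s_plus_a_pos: "0 < s t + a"
  using s_pos[of t] a_pos by simp

lemma y_eq: "y t = s t * (x t)\<^sup>2"
  using x_pos[of t] by (simp add: s_def)

lemma v_eq: "v t = s t * x t - b"
  using x_pos[of t] by (simp add: s_def v_def power2_eq_square)

lemma w_eq: "w t = 2 * s t * x t + s t + a"
  unfolding w_def v_eq p_def b_def by (simp add: field_simps)

lemma w_pos: "0 < w t"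
  unfolding w_eq using x_pos[of t] s_pos[of t] a_pos by (simp add: add_pos_pos)

lemma curve_eq: "4 * s t * (v t)\<^sup>2 = - b * q (s t)"
proof -
  have "F1 a (x t) (y t) = (x t)^4 * (4 * s t * (v t)\<^sup>2 + b * q (s t))"
    by (simp add: F1_def y_eq v_eq b_def q_def field_simps eval_nat_numeral)
  then show ?thesis
    using on_curve[of t] x_pos[of t] by simp
qed

lemma q_nonpos: "q (s t) \<le> 0"
proof -
  have "b * q (s t) = - (4 * s t * (v t)\<^sup>2)"
    using curve_eq[of t] by simp
  also have "\<dots> \<le> 0"
    using s_pos[of t] by simp
  finally show ?thesis
    using b_pos by (simp add: mult_le_0_iff)
qed

lemma w_reflection: "s t * (w t * (p (s t) - 2 * v t)) = (s t + a) * E (s t)"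
proof -
  have "s t * (w t * (p (s t) - 2 * v t)) = s t * (p (s t))\<^sup>2 - 4 * s t * (v t)\<^sup>2"
    unfolding w_def by (simp add: algebra_simps power2_eq_square)
  also have "\<dots> = (s t + a) * E (s t)"
    unfolding curve_eq p_def b_def q_def E_def by (simp add: field_simps eval_nat_numeral)
  finally show ?thesis .
qed

lemma v_reflection: "s t * ((b + v t) * (b - v t)) = b * (s t + a)\<^sup>2"
proof -
  have "s t * ((b + v t) * (b - v t)) = s t * b\<^sup>2 - 4 * s t * (v t)\<^sup>2 / 4"
    by (simp add: algebra_simps power2_eq_square)
  also have "\<dots> = b * (s t + a)\<^sup>2"
    unfolding curve_eq unfolding b_def q_def by (simp add: field_simps power2_eq_square)
  finally show ?thesis .
qed

lemma b_plus_v_pos: "0 < b + v t"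
  unfolding v_eq using s_pos[of t] x_pos[of t] by simp

lemma b_minus_v_pos: "0 < b - v t"
proof -
  have "0 < s t * ((b + v t) * (b - v t))"
    unfolding v_reflection using b_pos s_plus_a_pos[of t] by simp
  then show ?thesis
    using s_pos[of t] b_plus_v_pos[of t] by (simp add: zero_less_mult_iff)
qed

lemma has_derivative_s [derivative_intros]: "(s has_real_derivative - 4 * v t * w t) (at t)"
proof -
  have "((\<lambda>t. y t / (x t)\<^sup>2) has_real_derivative
      (Q1 a (x t) (y t) * (x t)\<^sup>2 - y t * (2 * x t * P1 a (x t) (y t))) / ((x t)\<^sup>2 * (x t)\<^sup>2)) (at t)"
    using x_pos[of t] by (auto intro!: derivative_eq_intros)
  moreover have "Q1 a (x t) (y t) * (x t)\<^sup>2 - y t * (2 * x t * P1 a (x t) (y t))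
      = - 4 * v t * w t * ((x t)\<^sup>2 * (x t)\<^sup>2)"
    by (simp add: P1_def Q1_def y_eq v_eq w_eq b_def field_simps eval_nat_numeral)
  ultimately show ?thesis
    using x_pos[of t] by (simp add: s_def[abs_def])
qed

lemma has_derivative_v [derivative_intros]:
  "(v has_real_derivative w t * (2 * b * ((s t)\<^sup>2 - a\<^sup>2) / (s t)\<^sup>2)) (at t)"
proof -
  define V where "V = Q1 a (x t) (y t) * x t - y t * P1 a (x t) (y t)"
  have "(s t)\<^sup>2 * V - w t * (2 * b * ((s t)\<^sup>2 - a\<^sup>2)) * (x t)\<^sup>2
      = (x t)\<^sup>2 * (a / 2 - s t / 2 + s t * x t) * (4 * s t * (v t)\<^sup>2 + b * q (s t))"
    by (simp add: V_def P1_def Q1_def y_eq v_eq w_eq b_def q_def field_simps eval_nat_numeral)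
  also have "\<dots> = 0"
    unfolding curve_eq by simp
  finally have "V / (x t * x t) = w t * (2 * b * ((s t)\<^sup>2 - a\<^sup>2) / (s t)\<^sup>2)"
    using s_pos[of t] x_pos[of t] by (simp add: field_simps power2_eq_square)
  moreover have "((\<lambda>t. y t / x t - b) has_real_derivative V / (x t * x t)) (at t)"
    unfolding V_def using x_pos[of t] by (auto intro!: derivative_eq_intros)
  ultimately show ?thesis
    by (simp add: v_def[abs_def])
qed

lemma has_derivative_w [derivative_intros]:
  "(w has_real_derivative w t * (4 * b * ((s t)\<^sup>2 - a\<^sup>2) / (s t)\<^sup>2 - 4 * v t)) (at t)"
proof -
  have "((\<lambda>t. 2 * v t + (s t + (3 + 5 * a) / 2)) has_real_derivative
      w t * (4 * b * ((s t)\<^sup>2 - a\<^sup>2) / (s t)\<^sup>2 - 4 * v t)) (at t)"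
    by (auto intro!: derivative_eq_intros simp: algebra_simps)
  then show ?thesis
    by (simp add: w_def[abs_def] p_def)
qed

lemma has_derivative_ln_s: "((\<lambda>t. ln (s t)) has_real_derivative - 4 * v t * w t / s t) (at t)"
  using s_pos[of t] by (auto intro!: derivative_eq_intros)

lemma has_derivative_ln_w:
  "((\<lambda>t. ln (w t)) has_real_derivative 4 * b * ((s t)\<^sup>2 - a\<^sup>2) / (s t)\<^sup>2 - 4 * v t) (at t)"
  using w_pos[of t] by (auto intro!: derivative_eq_intros)

lemma has_derivative_ln_v_ratio:
  "((\<lambda>t. ln (b + v t) - ln (b - v t)) has_real_derivative w t * (4 * b * ((s t - a) / (s t * (s t + a))))) (at t)"
proof -
  define c where "c = 2 * b * ((s t)\<^sup>2 - a\<^sup>2) / (s t)\<^sup>2"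
  have nonzero: "s t \<noteq> 0" "s t + a \<noteq> 0" "b \<noteq> 0"
    using s_pos[of t] s_plus_a_pos[of t] b_pos by auto
  have product: "(b + v t) * (b - v t) = b * (s t + a)\<^sup>2 / s t"
    using v_reflection[of t] nonzero by (simp add: nonzero_eq_divide_eq mult.commute)
  have "w t * c / (b + v t) + w t * c / (b - v t) = w t * c * (2 * b) / ((b + v t) * (b - v t))"
    using b_plus_v_pos[of t] b_minus_v_pos[of t] by (simp add: field_simps)
  also have "\<dots> = w t * (4 * b * ((s t - a) / (s t * (s t + a))))"
    unfolding product c_def using nonzero by (simp add: power2_eq_square square_diff_square_factored)
  finally have "w t * c / (b + v t) + w t * c / (b - v t) = w t * (4 * b * ((s t - a) / (s t * (s t + a))))" .
  moreover have "((\<lambda>t. ln (b + v t) - ln (b - v t)) has_real_derivative w t * c / (b + v t) + w t * c / (b - v t)) (at t)"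
    unfolding c_def using b_plus_v_pos[of t] b_minus_v_pos[of t] by (auto intro!: derivative_eq_intros simp: mult.commute)
  ultimately show ?thesis by simp
qed

lemma has_derivative_v_times_s_ratio:
  "((\<lambda>t. v t * ((s t - a) / (s t + a))) has_real_derivative
     w t * (2 * b * ((s t - a)\<^sup>2 / (s t)\<^sup>2 + a * q (s t) / (s t * (s t + a)\<^sup>2)))) (at t)"
proof -
  have nonzero: "s t \<noteq> 0" "s t + a \<noteq> 0"
    using s_pos[of t] s_plus_a_pos[of t] by auto
  have "((\<lambda>t. (s t - a) / (s t + a)) has_real_derivative 2 * a / (s t + a)\<^sup>2 * (- 4 * v t * w t)) (at t)"
    using nonzero by (auto intro!: derivative_eq_intros simp: field_simps power2_eq_square)
  from DERIV_mult[OF has_derivative_v this]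
  have "((\<lambda>t. v t * ((s t - a) / (s t + a))) has_real_derivative
      w t * (2 * b * ((s t)\<^sup>2 - a\<^sup>2) / (s t)\<^sup>2) * ((s t - a) / (s t + a))
        + 2 * a / (s t + a)\<^sup>2 * (- 4 * v t * w t) * v t) (at t)" .
  moreover have "w t * (2 * b * ((s t)\<^sup>2 - a\<^sup>2) / (s t)\<^sup>2) * ((s t - a) / (s t + a))
      = w t * (2 * b * ((s t - a)\<^sup>2 / (s t)\<^sup>2))"
    using nonzero by (simp add: divide_simps) (simp add: algebra_simps power2_eq_square)
  moreover have "2 * a / (s t + a)\<^sup>2 * (- 4 * v t * w t) * v t = w t * (2 * b * (a * q (s t) / (s t * (s t + a)\<^sup>2)))"
  proof -
    have "2 * a / (s t + a)\<^sup>2 * (- 4 * v t * w t) * v t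
        = - (2 * a * w t / (s t * (s t + a)\<^sup>2)) * (4 * s t * (v t)\<^sup>2)"
      using nonzero by (simp add: power2_eq_square)
    then show ?thesis
      unfolding curve_eq by simp
  qed
  ultimately show ?thesis
    by (simp only: distrib_left)
qed

lemma divergence_eq:
  "divergence (P1 a) (Q1 a) (x t) (y t) =
     4 * (4 * b * ((s t)\<^sup>2 - a\<^sup>2) / (s t)\<^sup>2 - 4 * v t) - 4 * (- 4 * v t * w t / s t)
     + 4 * a / s t * (v t - b * (s t - a) / s t)" (is "_ = ?rhs")
proof -
  have nonzero: "s t \<noteq> 0"
    using s_pos[of t] by simp
  have x_eq: "x t = (v t + b) / s t"
    unfolding v_eq using nonzero by simp
  have "(s t)\<^sup>2 * (21 * (1 + a) - (42 + 22 * a) * x t + 44 * y t)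
      = 21 * (1 + a) * (s t)\<^sup>2 - (42 + 22 * a) * (v t + b) * s t + 44 * (v t + b)\<^sup>2 * s t"
    unfolding y_eq[of t] x_eq using nonzero by (simp add: field_simps power2_eq_square)
  also have "\<dots> = 16 * b * ((s t)\<^sup>2 - a\<^sup>2) - 16 * v t * (s t)\<^sup>2 + 16 * v t * w t * s t
      + 4 * a * (v t * s t - b * (s t - a)) + 3 * (4 * s t * (v t)\<^sup>2 + b * q (s t))"
    unfolding w_def p_def q_def b_def by (simp add: field_simps power2_eq_square)
  also have "\<dots> = (s t)\<^sup>2 * ?rhs"
    unfolding curve_eq using nonzero by (simp add: field_simps power2_eq_square)
  finally show ?thesis
    unfolding divergence_P1_Q1 using nonzero by simp
qed

lemma remainder_eq:
  "4 * a / s t * (v t - b * (s t - a) / s t) =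
     odd_part (s t) * (- 4 * v t * w t) + even_part (s t) * w t"
proof -
  define D where "D = (s t + a) * E (s t)"
  define c where "c = b * (s t - a) / s t"
  define N where "N = q (s t) - 2 * (s t - a) * p (s t)"
  have nonzero: "s t \<noteq> 0" "D \<noteq> 0"
    using s_pos[of t] s_plus_a_pos[of t] E_pos[OF s_pos, of t] by (auto simp: D_def)
  have v_squared: "(v t)\<^sup>2 = - b * q (s t) / (4 * s t)"
    using curve_eq[of t] nonzero by (simp add: field_simps)
  have "4 * a / s t * (v t - c)
      = 4 * a / s t * (v t - c) * (s t * (w t * (p (s t) - 2 * v t)) / D)"
    unfolding w_reflection D_def[symmetric] using nonzero by simp
  also have "\<dots> = 4 * a * w t / D * ((v t - c) * (p (s t) - 2 * v t))"
    using nonzero by simp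
  also have "(v t - c) * (p (s t) - 2 * v t) = v t * (p (s t) + 2 * c) - 2 * (v t)\<^sup>2 - c * p (s t)"
    by (simp add: algebra_simps power2_eq_square)
  also have "\<dots> = v t * (p (s t) + 2 * c) + b * N / (2 * s t)"
    unfolding v_squared c_def N_def using nonzero by (simp add: field_simps)
  also have "4 * a * w t / D * \<dots>
      = - a * (p (s t) + 2 * c) / D * (- 4 * v t * w t) + 2 * a * b * N / (s t * D) * w t"
    unfolding distrib_left[of "4 * a * w t / D"] by (simp add: mult_ac)
  finally show ?thesis
    unfolding odd_part_def even_part_def c_def D_def N_def by (simp only: mult.assoc times_divide_eq_right)
qed

lemma divergence_decomposition:
  "divergence (P1 a) (Q1 a) (x t) (y t) =
     4 * (4 * b * ((s t)\<^sup>2 - a\<^sup>2) / (s t)\<^sup>2 - 4 * v t) - 4 * (- 4 * v t * w t / s t)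
     - 1/5 * (w t * (4 * b * ((s t - a) / (s t * (s t + a)))))
     + 2/5 * (w t * (2 * b * ((s t - a)\<^sup>2 / (s t)\<^sup>2 + a * q (s t) / (s t * (s t + a)\<^sup>2))))
     + odd_part (s t) * (- 4 * v t * w t)
     + 4/5 * b * (weight (s t) / ((s t)\<^sup>2 * (s t + a)\<^sup>2 * E (s t)) * w t)"
proof -
  have regroup: "A + (C + (4/5 * b * K - 4/5 * b * h + 4/5 * b * Z) * w t)
      = A - 1/5 * (w t * (4 * b * h)) + 2/5 * (w t * (2 * b * Z)) + C + 4/5 * b * (K * w t)" for A C K h Z :: real
    by (simp add: algebra_simps)
  show ?thesis
    unfolding divergence_eq remainder_eq even_part_eq[OF s_pos] by (rule regroup)
qed

lemma hyperbolic: "hyperbolic_cycle (P1 a) (Q1 a) x y T"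
proof -
  define k where "k t = weight (s t) / ((s t)\<^sup>2 * (s t + a)\<^sup>2 * E (s t)) * w t" for t
  obtain H where H: "\<And>s. 0 < s \<Longrightarrow> (H has_real_derivative odd_part s) (at s)"
    using antiderivative_greaterThan[OF continuous_on_odd_part] by blast
  have H_s: "((\<lambda>t. H (s t)) has_real_derivative odd_part (s t) * (- 4 * v t * w t)) (at t)" for t
    using H[OF s_pos] has_derivative_s by (rule DERIV_chain2)
  define G where "G t = 4 * ln (w t) - 4 * ln (s t) - 1/5 * (ln (b + v t) - ln (b - v t))
    + 2/5 * (v t * ((s t - a) / (s t + a))) + H (s t)" for t
  have k_pos: "0 < k t" for t
    using weight_pos[OF s_pos q_nonpos, of t] s_pos[of t] s_plus_a_pos[of t] E_pos[OF s_pos, of t] w_pos[of t]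
    by (simp add: k_def)
  show ?thesis
    unfolding hyperbolic_cycle_def
  proof (rule integral_exact_plus_nonneg_nonzero[OF period_pos, where G = G and c = "4/5 * b" and k = k and \<tau> = 0])
    show "(G has_real_derivative divergence (P1 a) (Q1 a) (x t) (y t) - 4/5 * b * k t) (at t)" for t
      unfolding G_def[abs_def] k_def divergence_decomposition add_diff_cancel_right'
      by (intro DERIV_add DERIV_diff DERIV_cmult has_derivative_ln_w has_derivative_ln_s
          has_derivative_ln_v_ratio has_derivative_v_times_s_ratio H_s)
    show "G T = G 0"
      by (simp add: G_def w_def v_def s_def closed_x closed_y)
    have "E (s t) \<noteq> 0" "s t + a \<noteq> 0" "s t \<noteq> 0" for t
      using E_pos[OF s_pos, of t] s_plus_a_pos[of t] s_pos[of t] by auto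
    moreover have "continuous_on {0..T} s" "continuous_on {0..T} w"
      by (rule DERIV_continuous_on[OF has_field_derivative_at_within], rule has_derivative_s has_derivative_w)+
    ultimately show "continuous_on {0..T} k"
      unfolding k_def[abs_def] weight_def q_def p_def E_def by (auto intro!: continuous_intros)
  qed (use b_pos k_pos[THEN less_imp_le] k_pos[of 0] period_pos in auto)
qed

end

section \<open>The second system\<close>

lemma divergence_P2_Q2: "divergence (P2 a) (Q2 a) u v = 7 + 16 * u + (8 + 10 * a) * v"
proof -
  have "divergence (P2 a) (Q2 a) u v = (5 + 12 * u + 4 * (1 + a) * v) + (2 + 4 * u + 2 * (2 + 3 * a) * v)"
    unfolding P2_def Q2_def by (rule divergence_eqI) (auto intro!: derivative_eq_intros)
  then show ?thesis by (simp add: algebra_simps)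
qed

lemma real_polynomial_function_P2_Q2:
  "real_polynomial_function (\<lambda>z. P2 a (fst z) (snd z))" "real_polynomial_function (\<lambda>z. Q2 a (fst z) (snd z))"
  unfolding P2_def Q2_def by (intro real_polynomial_function_planar)+

lemma F2_left_half_plane_tangent_imp_equilibrium:
  fixes a x y :: real
  assumes F: "F2 a x y = 0" and "x < 0" "a < 0" and tangent: "2 * x * Q2 a x y = y * P2 a x y"
  shows "P2 a x y = 0 \<and> Q2 a x y = 0"
proof -
  define K where "K = 2 * x\<^sup>2 + x * y + 2 * a * y^3"
  have "K * (2 * x * y + x + a * y\<^sup>2) = x * (2 * x * Q2 a x y - y * P2 a x y) + 2 * y * F2 a x y"
    unfolding K_def F2_def P2_def Q2_def by (simp add: algebra_simps eval_nat_numeral)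
  moreover have "K \<noteq> 0"
  proof -
    have "K\<^sup>2 = (y * (x + 2 * a * y\<^sup>2))\<^sup>2 + 4 * (- x) * (x + a * y\<^sup>2)\<^sup>2 + 4 * x * F2 a x y"
      unfolding K_def F2_def by (simp add: algebra_simps eval_nat_numeral)
    moreover have "x + a * y\<^sup>2 < 0"
      using \<open>x < 0\<close> \<open>a < 0\<close> by (simp add: add_neg_nonpos mult_nonpos_nonneg)
    then have "0 < 4 * (- x) * (x + a * y\<^sup>2)\<^sup>2"
      using \<open>x < 0\<close> by (intro mult_pos_pos) auto
    ultimately have "0 < K\<^sup>2"
      using zero_le_power2[of "y * (x + 2 * a * y\<^sup>2)"] unfolding F by linarith
    then show ?thesis by auto
  qed
  ultimately have U: "2 * x * y + x + a * y\<^sup>2 = 0"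
    using F tangent by simp
  then have "F2 a x y = x\<^sup>2 * (x - y)"
    unfolding F2_def by algebra
  then have "y = x"
    using F \<open>x < 0\<close> by simp
  with U have "x * (1 + (2 + a) * x) = 0"
    by (simp add: algebra_simps power2_eq_square)
  then have "1 + (2 + a) * x = 0"
    using \<open>x < 0\<close> by simp
  moreover have "P2 a x x = 5 * x * (1 + (2 + a) * x)" "Q2 a x x = 3 * x * (1 + (2 + a) * x)"
    unfolding P2_def Q2_def by (simp_all add: algebra_simps power2_eq_square)
  ultimately show ?thesis
    using \<open>y = x\<close> by simp
qed

locale system2_orbit = planar_orbit "P2 a" "Q2 a" "F2 a" x y T for a x y T +
  assumes a_greater: "- 1/2 < a" and a_neg: "a < 0"
begin

lemma x_nonzero: "x t \<noteq> 0"
  using on_curve[of t] not_equilibrium[OF real_polynomial_function_P2_Q2, of t] a_neg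
  by (auto simp: F2_def P2_def Q2_def)

lemma x_pos: "0 < x t"
proof (rule closed_nonvanishing_pos[OF period_pos has_derivative_y has_derivative_x x_nonzero closed_y closed_x])
  show "Q2 a (x u) (y u) * x u + - 1/2 * y u * P2 a (x u) (y u) \<noteq> 0" if "x u < 0" for u
    using F2_left_half_plane_tangent_imp_equilibrium[OF on_curve that a_neg]
      not_equilibrium[OF real_polynomial_function_P2_Q2, of u] by (auto simp: mult_ac)
qed

lemma y_nonzero: "y t \<noteq> 0"
proof
  assume "y t = 0"
  then have "(x t)\<^sup>2 + (x t)^3 = 0"
    using on_curve[of t] by (simp add: F2_def)
  moreover have "0 < (x t)\<^sup>2 + (x t)^3"
    using x_pos[of t] by (simp add: add_pos_pos)
  ultimately show False by simp
qed

lemma y_neg: "y t < 0"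
proof (rule ccontr)
  assume "\<not> y t < 0"
  then have pos: "0 < y u" for u
    using connected_nonvanishing_constant_sign[OF connected_UNIV continuous_on_y y_nonzero] by auto
  obtain u where "Q2 a (x u) (y u) = 0"
    using Rolle_real_derivative[OF period_pos has_derivative_y closed_y] by blast
  moreover have "0 < Q2 a (x u) (y u)"
    unfolding Q2_def using x_pos[of u] pos[of u] a_greater by (simp add: add_pos_pos)
  ultimately show False by simp
qed

definition r :: "real \<Rightarrow> real" where "r t = x t / (y t)\<^sup>2"
definition v :: "real \<Rightarrow> real" where "v t = 2 * (r t)\<^sup>2 * y t + r t + 2 * a"
definition w :: "real \<Rightarrow> real" where "w t = - (2 * r t * y t + r t + a)"

lemma x_eq: "x t = r t * (y t)\<^sup>2"
  using y_nonzero[of t] by (simp add: r_def)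

lemma r_pos: "0 < r t"
  using x_pos[of t] y_nonzero[of t] by (simp add: r_def)

lemma curve_eq: "(r t)^3 * (y t)\<^sup>2 + r t * (r t + 2 * a) * y t + (r t + a)\<^sup>2 = 0"
proof -
  have "F2 a (x t) (y t) = (y t)^4 * ((r t)^3 * (y t)\<^sup>2 + r t * (r t + 2 * a) * y t + (r t + a)\<^sup>2)"
    by (simp add: F2_def x_eq algebra_simps eval_nat_numeral)
  then show ?thesis
    using on_curve[of t] y_nonzero[of t] by simp
qed

lemma curve_eq_v: "(v t)\<^sup>2 = (r t + 2 * a)\<^sup>2 - 4 * r t * (r t + a)\<^sup>2"
proof -
  have "(v t)\<^sup>2 - ((r t + 2 * a)\<^sup>2 - 4 * r t * (r t + a)\<^sup>2)
      = 4 * r t * ((r t)^3 * (y t)\<^sup>2 + r t * (r t + 2 * a) * y t + (r t + a)\<^sup>2)"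
    unfolding v_def by (simp add: algebra_simps eval_nat_numeral)
  then show ?thesis
    using curve_eq by simp
qed

definition m :: "real \<Rightarrow> real" where "m s = s + 2 * a - s * (s + a)"

lemma r_mult_w: "r t * w t = m (r t) - v t"
  unfolding m_def v_def w_def by (simp add: algebra_simps eval_nat_numeral)

lemma w_reflection: "w t * (m (r t) + v t) = r t * ((r t + a) * (r t + a + 2))"
proof -
  have "r t * (w t * (m (r t) + v t)) = (m (r t))\<^sup>2 - (v t)\<^sup>2"
    unfolding mult.assoc[symmetric] r_mult_w by (simp add: algebra_simps power2_eq_square)
  also have "\<dots> = r t * (r t * ((r t + a) * (r t + a + 2)))"
    unfolding curve_eq_v m_def by (simp add: algebra_simps eval_nat_numeral)
  finally show ?thesis
    using r_pos[of t] by simp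
qed

lemma r_plus_2a_pos: "0 < r t + 2 * a"
proof (rule ccontr)
  assume "\<not> ?thesis"
  then have "0 \<le> r t * (r t + 2 * a) * y t"
    using r_pos[of t] y_neg[of t] by (simp add: mult_nonneg_nonpos mult_nonpos_nonpos)
  moreover have "0 < (r t)^3 * (y t)\<^sup>2"
    using r_pos[of t] y_nonzero[of t] by simp
  moreover have "0 \<le> (r t + a)\<^sup>2"
    by simp
  ultimately show False
    using curve_eq[of t] by linarith
qed

lemma r_plus_a_pos: "0 < r t + a"
  using r_plus_2a_pos[of t] a_neg by simp

lemma m_pos: "0 < m (r t)"
proof -
  have square_le: "4 * r t * (r t + a)\<^sup>2 \<le> (r t + 2 * a)\<^sup>2"
    using curve_eq_v[of t] zero_le_power2[of "v t"] by linarith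
  also have "(r t + 2 * a)\<^sup>2 < 1 * (r t + a)\<^sup>2"
    using r_plus_2a_pos[of t] a_neg by (simp add: power_strict_mono)
  finally have "4 * r t < 1"
    using r_plus_a_pos[of t] by (simp add: mult_less_cancel_right_pos)
  then have "(r t)\<^sup>2 < 4 * r t"
    using r_pos[of t] unfolding power2_eq_square by (intro mult_strict_right_mono) auto
  then have "(r t * (r t + a))\<^sup>2 < 4 * r t * (r t + a)\<^sup>2"
    using r_plus_a_pos[of t] unfolding power_mult_distrib by (intro mult_strict_right_mono) auto
  then have "(r t * (r t + a))\<^sup>2 < (r t + 2 * a)\<^sup>2"
    using square_le by linarith
  then have "r t * (r t + a) < r t + 2 * a"
    by (rule power2_less_imp_less) (simp add: r_plus_2a_pos less_imp_le)
  then show ?thesis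
    by (simp add: m_def)
qed

lemma w_pos: "0 < w t"
proof -
  have "0 < r t * ((r t + a) * (r t + a + 2))"
    using r_pos[of t] r_plus_a_pos[of t] by simp
  then have "0 < w t \<and> 0 < m (r t) + v t \<or> w t < 0 \<and> m (r t) + v t < 0"
    unfolding w_reflection[symmetric] zero_less_mult_iff by simp
  moreover have "m (r t) - v t < 0" if "w t < 0"
    unfolding r_mult_w[symmetric] using that r_pos[of t] by (simp add: mult_pos_neg)
  ultimately show ?thesis
    using m_pos[of t] by linarith
qed

lemma r_velocity_eq: "v t * w t / r t = r t + a - 2 * r t * (r t + a) * y t - 2 * (r t)\<^sup>2 * (y t)\<^sup>2"
proof -
  have "r t * (r t + a - 2 * r t * (r t + a) * y t - 2 * (r t)\<^sup>2 * (y t)\<^sup>2)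
      = v t * w t + 2 * ((r t)^3 * (y t)\<^sup>2 + r t * (r t + 2 * a) * y t + (r t + a)\<^sup>2)"
    unfolding v_def w_def by (simp add: algebra_simps eval_nat_numeral)
  then show ?thesis
    unfolding curve_eq using r_pos[of t] by (simp add: nonzero_divide_eq_eq mult.commute)
qed

lemma P2_Q2_eq_r_velocity:
  "P2 a (x t) (y t) * (y t)\<^sup>2 - x t * (2 * y t * Q2 a (x t) (y t)) = v t * w t / r t * ((y t)\<^sup>2 * (y t)\<^sup>2)"
  unfolding r_velocity_eq by (simp add: P2_def Q2_def x_eq algebra_simps eval_nat_numeral)

lemma has_derivative_r [derivative_intros]: "(r has_real_derivative v t * w t / r t) (at t)"
proof -
  have "((\<lambda>t. x t / (y t)\<^sup>2) has_real_derivative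
      (P2 a (x t) (y t) * (y t)\<^sup>2 - x t * (2 * y t * Q2 a (x t) (y t))) / ((y t)\<^sup>2 * (y t)\<^sup>2)) (at t)"
    using y_nonzero[of t] by (auto intro!: derivative_eq_intros)
  then show ?thesis
    unfolding P2_Q2_eq_r_velocity using y_nonzero[of t] by (simp add: r_def[abs_def])
qed

lemma has_derivative_v:
  "(v has_real_derivative (4 * r t * y t + 1) * (v t * w t / r t) + 2 * (r t)\<^sup>2 * Q2 a (x t) (y t)) (at t)"
proof -
  define R where "R = v t * w t / r t"
  have "((\<lambda>t. 2 * (r t)\<^sup>2 * y t + r t + 2 * a) has_real_derivative
      (4 * r t * y t + 1) * R + 2 * (r t)\<^sup>2 * Q2 a (x t) (y t)) (at t)"
    by (auto intro!: derivative_eq_intros simp: R_def[symmetric]) (simp add: algebra_simps)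
  then show ?thesis
    by (simp add: v_def[abs_def] R_def)
qed

lemma has_derivative_w [derivative_intros]:
  "(w has_real_derivative
      w t * ((2 * r t * y t * (1 - a - 2 * r t) + 4 * r t + 3 * a - v t * w t / r t) / r t)) (at t)"
proof -
  define R where "R = v t * w t / r t"
  have "r t * - (2 * R * y t + 2 * r t * Q2 a (x t) (y t) + R) + R * w t
      = w t * (2 * r t * y t * (1 - a - 2 * r t) + 4 * r t + 3 * a)
        + 2 * ((r t)^3 * (y t)\<^sup>2 + r t * (r t + 2 * a) * y t + (r t + a)\<^sup>2)"
    unfolding R_def r_velocity_eq by (simp add: w_def Q2_def x_eq algebra_simps eval_nat_numeral)
  then have "- (2 * R * y t + 2 * r t * Q2 a (x t) (y t) + R)
      = w t * ((2 * r t * y t * (1 - a - 2 * r t) + 4 * r t + 3 * a - R) / r t)"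
    unfolding curve_eq using r_pos[of t] by (simp add: field_simps)
  moreover have "((\<lambda>t. - (2 * r t * y t + r t + a)) has_real_derivative
      - (2 * R * y t + 2 * r t * Q2 a (x t) (y t) + R)) (at t)"
    by (auto intro!: derivative_eq_intros simp: R_def[symmetric])
  ultimately show ?thesis
    by (simp add: w_def[abs_def] R_def)
qed

lemma divergence_eq:
  "divergence (P2 a) (Q2 a) (x t) (y t) =
     2 * ((2 * r t * y t * (1 - a - 2 * r t) + 4 * r t + 3 * a - v t * w t / r t) / r t)
     + 2 * (Q2 a (x t) (y t) / y t) - 2 * (v t * w t / r t / r t) - v t / r t"
proof -
  have y_log_derivative: "Q2 a (x t) (y t) / y t = r t * y t + 2 + 4 * r t * (y t)\<^sup>2 + (2 + 3 * a) * y t"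
    using y_nonzero[of t] by (simp add: Q2_def x_eq field_simps power2_eq_square)
  show ?thesis
    unfolding y_log_derivative divergence_P2_Q2 r_velocity_eq using r_pos[of t]
    by (simp add: v_def x_eq divide_simps) (simp add: algebra_simps power2_eq_square)
qed

lemma v_div_r_eq:
  "v t / r t = m (r t) / (r t * ((r t + a) * (r t + a + 2))) * (v t * w t / r t)
     + (v t)\<^sup>2 * w t / ((r t)\<^sup>2 * ((r t + a) * (r t + a + 2)))"
proof -
  define D where "D = (r t + a) * (r t + a + 2)"
  have nonzero: "r t \<noteq> 0" "D \<noteq> 0"
    using r_pos[of t] r_plus_a_pos[of t] by (auto simp: D_def)
  have "m (r t) / (r t * D) * (v t * w t / r t) + (v t)\<^sup>2 * w t / ((r t)\<^sup>2 * D)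
      = v t * (w t * (m (r t) + v t)) / ((r t)\<^sup>2 * D)"
    using nonzero by (simp add: field_simps power2_eq_square)
  also have "\<dots> = v t / r t"
    unfolding w_reflection D_def[symmetric] using nonzero by (simp add: power2_eq_square)
  finally show ?thesis
    unfolding D_def by simp
qed

lemma v_not_identically_zero:
  obtains t where "t \<in> {0..T}" "v t \<noteq> 0"
proof -
  have "v T = v 0"
    by (simp add: v_def r_def closed_x closed_y)
  then obtain t where t: "t \<in> {0..T}"
    and critical: "(4 * r t * y t + 1) * (v t * w t / r t) + 2 * (r t)\<^sup>2 * Q2 a (x t) (y t) = 0"
    using Rolle_real_derivative[OF period_pos has_derivative_v] by blast
  have "v t \<noteq> 0"
  proof
    assume "v t = 0"
    then have "Q2 a (x t) (y t) = 0"
      using critical r_pos[of t] by simp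
    moreover from this have "P2 a (x t) (y t) = 0"
      using P2_Q2_eq_r_velocity[of t] \<open>v t = 0\<close> y_nonzero[of t] by simp
    ultimately show False
      using not_equilibrium[OF real_polynomial_function_P2_Q2, of t] by simp
  qed
  with t show thesis by (rule that)
qed

lemma hyperbolic: "hyperbolic_cycle (P2 a) (Q2 a) x y T"
proof -
  obtain t0 where t0: "t0 \<in> {0..T}" "v t0 \<noteq> 0"
    by (rule v_not_identically_zero)
  have "continuous_on {- a<..} (\<lambda>s. m s / (s * ((s + a) * (s + a + 2))))"
    unfolding m_def using a_neg by (auto intro!: continuous_intros)
  then obtain H where H: "\<And>s. - a < s \<Longrightarrow> (H has_real_derivative m s / (s * ((s + a) * (s + a + 2)))) (at s)"
    by (rule antiderivative_greaterThan) blast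
  have H_r: "((\<lambda>t. H (r t)) has_real_derivative
      m (r t) / (r t * ((r t + a) * (r t + a + 2))) * (v t * w t / r t)) (at t)" for t
    using H[of "r t"] r_plus_a_pos[of t] by (intro DERIV_chain2[OF _ has_derivative_r]) simp
  define G where "G t = 2 * ln (w t) + 2 * ln (- y t) - 2 * ln (r t) - H (r t)" for t
  define k where "k t = (v t)\<^sup>2 * w t / ((r t)\<^sup>2 * ((r t + a) * (r t + a + 2)))" for t
  show ?thesis
    unfolding hyperbolic_cycle_def
  proof (rule integral_exact_plus_nonneg_nonzero[OF period_pos, where G = G and c = "- 1" and k = k])
    show "(G has_real_derivative divergence (P2 a) (Q2 a) (x t) (y t) - - 1 * k t) (at t)" for t
      unfolding G_def[abs_def] divergence_eq v_div_r_eq[of t] k_def using w_pos[of t] y_neg[of t] r_pos[of t]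
      by (auto intro!: derivative_eq_intros H_r simp: mult.commute)
    show "G T = G 0"
      by (simp add: G_def w_def r_def closed_x closed_y)
    have "continuous_on {0..T} r"
      by (rule DERIV_continuous_on[OF has_field_derivative_at_within], rule has_derivative_r)
    then show "continuous_on {0..T} k"
      unfolding k_def[abs_def] v_def w_def using r_pos r_plus_a_pos
      by (auto intro!: continuous_intros simp: less_imp_neq[symmetric] add_pos_pos)
    show "0 \<le> k t" for t
      using w_pos[of t] r_plus_a_pos[of t] by (simp add: k_def)
    show "k t0 \<noteq> 0"
      using t0(2) w_pos[of t0] r_pos[of t0] r_plus_a_pos[of t0] by (simp add: k_def)
  qed (use t0 in simp_all)
qed

end

section \<open>The third system\<close>

lemma divergence_P3_Q3: "divergence (P3 a) (Q3 a) u v = 4 - 10 * a * u - 4 * v"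
proof -
  have "divergence (P3 a) (Q3 a) u v = (4 - 8 * a * u + 12 * v) + (- 2 * a * u - 16 * v)"
    unfolding P3_def Q3_def by (rule divergence_eqI) (auto intro!: derivative_eq_intros)
  then show ?thesis by simp
qed

lemma real_polynomial_function_P3_Q3:
  "real_polynomial_function (\<lambda>z. P3 a (fst z) (snd z))" "real_polynomial_function (\<lambda>z. Q3 a (fst z) (snd z))"
  unfolding P3_def Q3_def by (intro real_polynomial_function_planar)+

locale system3_orbit = planar_orbit "P3 a" "Q3 a" "F3 a" x y T for a x y T +
  assumes a_pos: "0 < a"
begin

definition v :: "real \<Rightarrow> real" where "v t = x t * y t + 1/2"
definition w :: "real \<Rightarrow> real" where "w t = v t + 3 * x t"

lemma x_nonzero: "x t \<noteq> 0"
  using on_curve[of t] by (auto simp: F3_def)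

lemma y_eq: "y t = (v t - 1/2) / x t"
  using x_nonzero[of t] by (simp add: v_def)

lemma curve_eq: "(v t)\<^sup>2 = x t * (x t - 1 - a * (x t)\<^sup>2)"
proof -
  have "(v t)\<^sup>2 - x t * (x t - 1 - a * (x t)\<^sup>2) = F3 a (x t) (y t)"
    unfolding v_def F3_def by (simp add: field_simps eval_nat_numeral)
  then show ?thesis using on_curve by simp
qed

lemma P3_eq: "P3 a (x t) (y t) = 4 * (v t / x t) * w t"
proof -
  have "x t * P3 a (x t) (y t) = 4 * v t * w t - 4 * F3 a (x t) (y t)"
    unfolding v_def w_def F3_def P3_def by (simp add: field_simps eval_nat_numeral)
  then show ?thesis using on_curve x_nonzero[of t] by (simp add: field_simps)
qed

lemma v_derivative_eq:
  "P3 a (x t) (y t) * y t + Q3 a (x t) (y t) * x t = w t * (4 * x t - 2 - 6 * a * (x t)\<^sup>2) / x t"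
proof -
  have "x t * (P3 a (x t) (y t) * y t + Q3 a (x t) (y t) * x t)
      = w t * (4 * x t - 2 - 6 * a * (x t)\<^sup>2) + 4 * F3 a (x t) (y t)"
    unfolding v_def w_def F3_def P3_def Q3_def by (simp add: field_simps eval_nat_numeral)
  then show ?thesis using on_curve x_nonzero[of t] by (simp add: field_simps)
qed

lemma has_derivative_v [derivative_intros]:
  "(v has_real_derivative w t * (4 * x t - 2 - 6 * a * (x t)\<^sup>2) / x t) (at t)"
  unfolding v_derivative_eq[symmetric] v_def[abs_def]
  by (auto intro!: derivative_eq_intros)

lemma v_critical_imp_P3_nonzero:
  assumes "w t * (4 * x t - 2 - 6 * a * (x t)\<^sup>2) = 0"
  shows "P3 a (x t) (y t) \<noteq> 0"
  using not_equilibrium[OF real_polynomial_function_P3_Q3, of t] v_derivative_eq[of t] assms x_nonzero[of t]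
  by auto

lemma x_pos: "0 < x t"
proof (rule closed_nonvanishing_pos[OF period_pos has_derivative_x has_derivative_x x_nonzero closed_x closed_x])
  fix u assume "x u < 0"
  have "P3 a (x u) (y u) \<noteq> 0"
  proof
    assume P3_zero: "P3 a (x u) (y u) = 0"
    have "0 < (v u)\<^sup>2"
      unfolding curve_eq using \<open>x u < 0\<close> a_pos
      by (intro mult_neg_neg) (auto intro: less_le_trans[of _ 0])
    then have "w u = 0"
      using P3_zero x_nonzero[of u] by (auto simp: P3_eq)
    then show False
      using v_critical_imp_P3_nonzero[of u] P3_zero by simp
  qed
  then show "P3 a (x u) (y u) * x u + 0 * x u * P3 a (x u) (y u) \<noteq> 0"
    using x_nonzero[of u] by simp
qed

lemma w_pos: "0 < w t"
proof -
  have "w t * (3 * x t - v t) = x t * (a * (x t)\<^sup>2 + 8 * x t + 1)"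
    using curve_eq[of t] unfolding w_def by (simp add: algebra_simps power2_eq_square)
  also have "\<dots> > 0"
    using x_pos[of t] a_pos by (simp add: add_pos_pos)
  finally show ?thesis
    using x_pos[of t] unfolding w_def zero_less_mult_iff by linarith
qed

lemma has_derivative_w [derivative_intros]:
  "(w has_real_derivative w t * ((12 * v t + 4 * x t - 2 - 6 * a * (x t)\<^sup>2) / x t)) (at t)"
proof -
  have "((\<lambda>t. v t + 3 * x t) has_real_derivative w t * (4 * x t - 2 - 6 * a * (x t)\<^sup>2) / x t + 3 * P3 a (x t) (y t)) (at t)"
    by (auto intro!: derivative_eq_intros)
  moreover have "w t * (4 * x t - 2 - 6 * a * (x t)\<^sup>2) / x t + 3 * P3 a (x t) (y t)
      = w t * ((12 * v t + 4 * x t - 2 - 6 * a * (x t)\<^sup>2) / x t)"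
    unfolding P3_eq using x_nonzero[of t] by (simp add: field_simps)
  ultimately show ?thesis
    by (simp add: w_def[abs_def])
qed

lemma divergence_eq:
  "divergence (P3 a) (Q3 a) (x t) (y t) =
     3 * ((12 * v t + 4 * x t - 2 - 6 * a * (x t)\<^sup>2) / x t) - 10/3 * (P3 a (x t) (y t) / x t) + 16/3 * (v t / x t)\<^sup>2"
proof -
  have v_div_x_squared: "(v t / x t)\<^sup>2 = (x t - 1 - a * (x t)\<^sup>2) / x t"
    unfolding power_divide curve_eq using x_nonzero[of t] by (simp add: power2_eq_square)
  have x_log_derivative: "P3 a (x t) (y t) / x t = 4 * (v t / x t)\<^sup>2 + 12 * (v t / x t)"
    unfolding P3_eq w_def using x_nonzero[of t] by (simp add: field_simps power2_eq_square)
  have "divergence (P3 a) (Q3 a) (x t) (y t) = 4 - 10 * a * x t - 4 * ((v t - 1/2) / x t)"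
    by (simp only: divergence_P3_Q3 y_eq)
  also have "\<dots> = 3 * ((12 * v t + 4 * x t - 2 - 6 * a * (x t)\<^sup>2) / x t)
      - 10/3 * (4 * ((x t - 1 - a * (x t)\<^sup>2) / x t) + 12 * (v t / x t)) + 16/3 * ((x t - 1 - a * (x t)\<^sup>2) / x t)"
    using x_nonzero[of t] by (simp add: field_simps power2_eq_square)
  finally show ?thesis
    by (simp only: x_log_derivative v_div_x_squared)
qed

lemma v_not_identically_zero:
  obtains t where "t \<in> {0..T}" "v t \<noteq> 0"
proof -
  have "v T = v 0"
    by (simp add: v_def closed_x closed_y)
  then obtain t where "t \<in> {0..T}" "w t * (4 * x t - 2 - 6 * a * (x t)\<^sup>2) / x t = 0"
    using Rolle_real_derivative[OF period_pos has_derivative_v] by blast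
  then show thesis
    using that v_critical_imp_P3_nonzero[of t] x_nonzero[of t] by (auto simp: P3_eq)
qed

lemma hyperbolic: "hyperbolic_cycle (P3 a) (Q3 a) x y T"
proof -
  obtain t0 where t0: "t0 \<in> {0..T}" "v t0 \<noteq> 0"
    by (rule v_not_identically_zero)
  define G where "G t = 3 * ln (w t) - 10/3 * ln (x t)" for t
  show ?thesis
    unfolding hyperbolic_cycle_def
  proof (rule integral_exact_plus_nonneg_nonzero[OF period_pos, where G = G and c = "16/3" and k = "\<lambda>t. (v t / x t)\<^sup>2"])
    show "(G has_real_derivative divergence (P3 a) (Q3 a) (x t) (y t) - 16/3 * (v t / x t)\<^sup>2) (at t)" for t
      unfolding G_def[abs_def] divergence_eq using w_pos[of t] x_pos[of t]
      by (auto intro!: derivative_eq_intros simp: field_simps)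
    show "G T = G 0"
      by (simp add: G_def w_def v_def closed_x closed_y)
    show "continuous_on {0..T} (\<lambda>t. (v t / x t)\<^sup>2)"
      unfolding v_def using x_nonzero by (auto intro!: continuous_intros)
  qed (use t0 x_nonzero in auto)
qed

end

section \<open>Hyperbolicity\<close>

theorem theorem6:
  shows "(\<forall>a x y T. 0 < a \<and> a < 3/13 \<and> periodic_orbit_on (P1 a) (Q1 a) (F1 a) x y T
            \<longrightarrow> hyperbolic_cycle (P1 a) (Q1 a) x y T)
       \<and> (\<forall>a x y T. (-71 + 17 * sqrt 17) / 32 < a \<and> a < 0 \<and> periodic_orbit_on (P2 a) (Q2 a) (F2 a) x y T
            \<longrightarrow> hyperbolic_cycle (P2 a) (Q2 a) x y T)
       \<and> (\<forall>a x y T. 0 < a \<and> a < 1/4 \<and> periodic_orbit_on (P3 a) (Q3 a) (F3 a) x y T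
            \<longrightarrow> hyperbolic_cycle (P3 a) (Q3 a) x y T)"
proof (intro conjI allI impI; elim conjE)
  fix a T :: real and x y :: "real \<Rightarrow> real"
  show "hyperbolic_cycle (P1 a) (Q1 a) x y T"
    if "0 < a" "a < 3/13" "periodic_orbit_on (P1 a) (Q1 a) (F1 a) x y T"
  proof -
    interpret system1_orbit a x y T using that by unfold_locales
    show ?thesis by (rule hyperbolic)
  qed
  show "hyperbolic_cycle (P2 a) (Q2 a) x y T"
    if "(-71 + 17 * sqrt 17) / 32 < a" "a < 0" "periodic_orbit_on (P2 a) (Q2 a) (F2 a) x y T"
  proof -
    have "4 \<le> sqrt 17" by (rule real_le_rsqrt) simp
    then have "- 1/2 < a" using that(1) by simp
    then interpret system2_orbit a x y T using that by unfold_locales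
    show ?thesis by (rule hyperbolic)
  qed
  show "hyperbolic_cycle (P3 a) (Q3 a) x y T"
    if "0 < a" "a < 1/4" "periodic_orbit_on (P3 a) (Q3 a) (F3 a) x y T"
  proof -
    interpret system3_orbit a x y T using that by unfold_locales
    show ?thesis by (rule hyperbolic)
  qed
qed

end
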